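(* Let $Q=Q^t\in\mathbb{R}^{2d\times2d}$, $L\in\mathrm{GL}(2d,\mathbb{R})$, $U\in\mathrm{U}(2d,\mathbb{C})$, let $\mathbf{A}=\mathcal{V}_Q\mathcal{D}_L\mathcal{R}_U\in\mathrm{Sp}(4d,\mathbb{R})$, and assume that $U^tU$ is $d\times d$ block-diagonal. Then there exist non-zero functions $f,g\in L^2(\mathbb{R}^d)$ such that $W_{\mathbf{A}}(f,g)$ has compact support.
   Context: $\mathrm{Sp}(2n,\mathbb{R})=\{M\in\mathbb{R}^{2n\times 2n}: M^t\mathcal{J}M=\mathcal{J}\}$, $\mathcal{J}=\begin{pmatrix}0&I\\-I&0\end{pmatrix}$. For $(x,\omega)\in\mathbb{R}^n\times\mathbb{R}^n$, $\rho(x,\omega)f(t)=e^{-\pi i x\cdot\omega}e^{2\pi i\omega\cdot t}f(t-x)$. For $M\in\mathrm{Sp}(2n,\mathbb{R})$, $\widehat{M}$ denotes an associated metaplectic operator: a unitary operator on $L^2(\mathbb{R}^n)$ with $\rho(M\lambda)=\widehat M\rho(\lambda)\widehat M^{-1}$ for all $\lambda\in\mathbb{R}^{2n}$; it is unique up to a factor of modulus 1 (irrelevant here). Elementary symplectic matrices: for $Q=Q^t\in\mathbb{R}^{n\times n}$, $L\in\mathrm{GL}(n,\mathbb{R})$, $U=A+iB\in\mathrm{U}(n,\mathbb{C})$ ($A,B$ real), $$\mathcal{V}_Q=\begin{pmatrix}I&0\\Q&I\end{pmatrix},\quad \mathcal{D}_L=\begin{pmatrix}L&0\\0&L^{-t}\end{pmatrix},\quad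 \mathcal{R}_U=\begin{pmatrix}A&B\\-B&A\end{pmatrix}.$$ For $\mathbf{A}\in\mathrm{Sp}(4d,\mathbb{R})$, $\widehat{\mathbf{A}}$ acts on $L^2(\mathbb{R}^{2d})$, and the metaplectic time-frequency representation is $W_{\mathbf{A}}(f,g)=\widehat{\mathbf{A}}(f\otimes\overline g)$ for $f,g\in L^2(\mathbb{R}^d)$, where $(f\otimes \overline g)(x,y)=f(x)\overline{g(y)}$. A $2d\times2d$ matrix is called $d\times d$ block-diagonal if it has the form $\begin{pmatrix}U_1&0\\0&U_2\end{pmatrix}$ with $U_1,U_2$ of size $d\times d$. $U^t$ is the transpose (no conjugation). *)

theory Defs
  imports "HOL-Analysis.Analysis"
begin

section \<open>Block matrices\<close>

text \<open>
  \<open>\<real>\<^sup>2\<^sup>n\<close> is \<^typ>\<open>real ^ ('n + 'n)\<close>: the coordinates \<open>Inl i\<close> form the first half, the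
  coordinates \<open>Inr i\<close> the second.
\<close>

definition block ::
  "'a ^ 'n ^ 'n \<Rightarrow> 'a ^ 'n ^ 'n \<Rightarrow> 'a ^ 'n ^ 'n \<Rightarrow> 'a ^ 'n ^ 'n \<Rightarrow> 'a ^ ('n::finite + 'n) ^ ('n + 'n)"
  where "block A B C D =
    (\<chi> i j. case i of
        Inl k \<Rightarrow> (case j of Inl l \<Rightarrow> A $ k $ l | Inr l \<Rightarrow> B $ k $ l)
      | Inr k \<Rightarrow> (case j of Inl l \<Rightarrow> C $ k $ l | Inr l \<Rightarrow> D $ k $ l))"

definition block_diagonal :: "'a::zero ^ ('n::finite + 'n) ^ ('n + 'n) \<Rightarrow> bool"
  where "block_diagonal M \<longleftrightarrow> (\<exists>U1 U2. M = block U1 0 0 U2)"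

definition fst_half :: "'a ^ ('n::finite + 'n) \<Rightarrow> 'a ^ 'n"
  where "fst_half z = (\<chi> i. z $ Inl i)"

definition snd_half :: "'a ^ ('n::finite + 'n) \<Rightarrow> 'a ^ 'n"
  where "snd_half z = (\<chi> i. z $ Inr i)"


section \<open>Symplectic matrices\<close>

definition J_mat :: "real ^ ('n::finite + 'n) ^ ('n + 'n)"
  where "J_mat = block 0 (mat 1) (- mat 1) 0"

definition Sp :: "(real ^ ('n::finite + 'n) ^ ('n + 'n)) set"
  where "Sp = {M. transpose M ** J_mat ** M = J_mat}"

definition V_mat :: "real ^ 'n::finite ^ 'n \<Rightarrow> real ^ ('n + 'n) ^ ('n + 'n)"
  where "V_mat Q = block (mat 1) 0 Q (mat 1)"

definition D_mat :: "real ^ 'n::finite ^ 'n \<Rightarrow> real ^ ('n + 'n) ^ ('n + 'n)"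
  where "D_mat L = block L 0 0 (transpose (matrix_inv L))"

definition Re_mat :: "complex ^ 'n ^ 'm \<Rightarrow> real ^ 'n ^ 'm"
  where "Re_mat U = (\<chi> i j. Re (U $ i $ j))"

definition Im_mat :: "complex ^ 'n ^ 'm \<Rightarrow> real ^ 'n ^ 'm"
  where "Im_mat U = (\<chi> i j. Im (U $ i $ j))"

definition R_mat :: "complex ^ 'n::finite ^ 'n \<Rightarrow> real ^ ('n + 'n) ^ ('n + 'n)"
  where "R_mat U = block (Re_mat U) (Im_mat U) (- Im_mat U) (Re_mat U)"

definition conj_transpose :: "complex ^ 'n ^ 'm \<Rightarrow> complex ^ 'm ^ 'n"
  where "conj_transpose U = (\<chi> i j. cnj (U $ j $ i))"

definition unitary_matrix :: "complex ^ 'n::finite ^ 'n \<Rightarrow> bool"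
  where "unitary_matrix U \<longleftrightarrow>
    conj_transpose U ** U = mat 1 \<and> U ** conj_transpose U = mat 1"


section \<open>Square-integrable functions and metaplectic operators\<close>

text \<open>
  Elements of \<open>L\<^sup>2\<close> are represented by Borel measurable functions (every class of Lebesgue
  measurable functions modulo null sets contains one), so equality in \<open>L\<^sup>2\<close> is
  \<open>ae_eq\<close>, and an operator on \<open>L\<^sup>2\<close> is a map on representatives that respects \<open>ae_eq\<close>.
  What such a map does outside \<open>L2\<close> is irrelevant.
\<close>

definition L2 :: "('a::euclidean_space \<Rightarrow> complex) set"
  where "L2 = {f \<in> borel_measurable lborel. integrable lborel (\<lambda>x. (cmod (f x))\<^sup>2)}"

definition ae_eq :: "('a::euclidean_space \<Rightarrow> complex) \<Rightarrow> ('a \<Rightarrow> complex) \<Rightarrow> bool"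
  where "ae_eq f g \<longleftrightarrow> (AE x in lborel. f x = g x)"

definition L2_inner :: "('a::euclidean_space \<Rightarrow> complex) \<Rightarrow> ('a \<Rightarrow> complex) \<Rightarrow> complex"
  where "L2_inner f g = (LINT x|lborel. f x * cnj (g x))"

definition L2_unitary ::
  "(('a::euclidean_space \<Rightarrow> complex) \<Rightarrow> ('a \<Rightarrow> complex)) \<Rightarrow> bool"
  where "L2_unitary T \<longleftrightarrow>
    (\<forall>f\<in>L2. T f \<in> L2) \<and>
    (\<forall>f\<in>L2. \<forall>g\<in>L2. ae_eq f g \<longrightarrow> ae_eq (T f) (T g)) \<and>
    (\<forall>f\<in>L2. \<forall>g\<in>L2. \<forall>a b. ae_eq (T (\<lambda>x. a * f x + b * g x)) (\<lambda>x. a * T f x + b * T g x)) \<and>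
    (\<forall>f\<in>L2. \<forall>g\<in>L2. L2_inner (T f) (T g) = L2_inner f g) \<and>
    (\<forall>h\<in>L2. \<exists>f\<in>L2. ae_eq (T f) h)"

definition tf_shift :: "real ^ ('n::finite + 'n) \<Rightarrow> (real ^ 'n \<Rightarrow> complex) \<Rightarrow> (real ^ 'n \<Rightarrow> complex)"
  where "tf_shift z f t =
    (let x = fst_half z; \<omega> = snd_half z in
      exp (- \<i> * pi * (x \<bullet> \<omega>)) * exp (2 * pi * \<i> * (\<omega> \<bullet> t)) * f (t - x))"

text \<open>
  The relation \<open>\<rho>(M z) = T \<rho>(z) T\<^sup>-\<^sup>1\<close> is written as \<open>\<rho>(M z) T = T \<rho>(z)\<close>: the unitary \<open>T\<close> is
  invertible only modulo null sets.
\<close>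

definition metaplectic ::
  "real ^ ('n::finite + 'n) ^ ('n + 'n) \<Rightarrow> ((real ^ 'n \<Rightarrow> complex) \<Rightarrow> (real ^ 'n \<Rightarrow> complex)) \<Rightarrow> bool"
  where "metaplectic M T \<longleftrightarrow>
    M \<in> Sp \<and> L2_unitary T \<and>
    (\<forall>z. \<forall>f\<in>L2. ae_eq (tf_shift (M *v z) (T f)) (T (tf_shift z f)))"

definition tensor_cnj ::
  "(real ^ 'd::finite \<Rightarrow> complex) \<Rightarrow> (real ^ 'd \<Rightarrow> complex) \<Rightarrow> (real ^ ('d + 'd) \<Rightarrow> complex)"
  where "tensor_cnj f g z = f (fst_half z) * cnj (g (snd_half z))"

text \<open>
  The time-frequency representation \<open>W\<^sub>A\<close> depends on the choice of the metaplectic operator \<open>T\<close>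
  for \<open>A\<close> (that is, \<^term>\<open>metaplectic A T\<close>), which is therefore the parameter here.
\<close>

definition metaplectic_tfr ::
  "((real ^ ('d::finite + 'd) \<Rightarrow> complex) \<Rightarrow> (real ^ ('d + 'd) \<Rightarrow> complex)) \<Rightarrow>
    (real ^ 'd \<Rightarrow> complex) \<Rightarrow> (real ^ 'd \<Rightarrow> complex) \<Rightarrow> (real ^ ('d + 'd) \<Rightarrow> complex)"
  where "metaplectic_tfr T f g = T (tensor_cnj f g)"

text \<open>
  The support of an \<open>L\<^sup>2\<close> class: the complement of the largest open set on which the function
  vanishes almost everywhere.
\<close>

definition ess_support :: "('a::euclidean_space \<Rightarrow> complex) \<Rightarrow> 'a set"
  where "ess_support f = - \<Union>{V. open V \<and> (AE x in lborel. x \<in> V \<longrightarrow> f x = 0)}"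


section \<open>The elementary matrices are symplectic\<close>

lemma sum_UNIV_Plus:
  "(\<Sum>i\<in>UNIV. h i) = (\<Sum>i\<in>UNIV. h (Inl i)) + (\<Sum>i\<in>UNIV. h (Inr i))"
  for h :: "'n::finite + 'n \<Rightarrow> 'a::comm_monoid_add"
  by (subst UNIV_Plus_UNIV [symmetric], subst sum.Plus) (auto simp: comp_def)

lemma block_mult:
  "block A B C D ** block A' B' C' D' =
    block (A ** A' + B ** C') (A ** B' + B ** D') (C ** A' + D ** C') (C ** B' + D ** D')"
  for A :: "'a::semiring_1 ^ 'n::finite ^ 'n"
  by (auto simp: block_def matrix_matrix_mult_def vec_eq_iff sum_UNIV_Plus split: sum.splits)

lemma transpose_block:
  "transpose (block A B C D) = block (transpose A) (transpose C) (transpose B) (transpose D)"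
  by (auto simp: block_def transpose_def vec_eq_iff split: sum.splits)

lemma transpose_zero: "transpose 0 = (0 :: 'a::zero ^ 'n ^ 'm)"
  by (simp add: transpose_def vec_eq_iff)

lemma transpose_uminus: "transpose (- A) = - transpose (A :: real ^ 'n ^ 'm)"
  by (simp add: transpose_def vec_eq_iff)

lemma mult_uminus_left: "(- A) ** B = - (A ** (B :: real ^ 'n ^ 'm))"
  by (simp add: matrix_matrix_mult_def vec_eq_iff sum_negf)

lemma mult_uminus_right: "A ** (- B) = - (A ** (B :: real ^ 'n ^ 'm))"
  by (simp add: matrix_matrix_mult_def vec_eq_iff sum_negf)

lemmas block_simps =
  block_mult transpose_block transpose_zero transpose_uminus transpose_mat
  mult_uminus_left mult_uminus_right matrix_mul_lid matrix_mul_rid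

lemma Sp_mult: "M \<in> Sp \<Longrightarrow> N \<in> Sp \<Longrightarrow> M ** N \<in> Sp"
  unfolding Sp_def mem_Collect_eq matrix_transpose_mul by (metis matrix_mul_assoc)

lemma V_mat_in_Sp: "transpose Q = Q \<Longrightarrow> V_mat Q \<in> Sp"
  by (simp add: Sp_def V_mat_def J_mat_def block_simps)

lemma D_mat_in_Sp:
  assumes "invertible L"
  shows "D_mat L \<in> Sp"
proof -
  have "L ** matrix_inv L = mat 1 \<and> matrix_inv L ** L = mat 1"
    using assms unfolding invertible_def matrix_inv_def by (rule someI_ex)
  moreover from this have "transpose L ** transpose (matrix_inv L) = mat 1"
    by (metis matrix_transpose_mul transpose_mat)
  ultimately show ?thesis
    by (simp add: Sp_def D_mat_def J_mat_def block_simps)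
qed

lemma R_mat_in_Sp:
  assumes "unitary_matrix U"
  shows "R_mat U \<in> Sp"
proof -
  let ?A = "Re_mat U" and ?B = "Im_mat U"
  have eq: "(\<Sum>k\<in>UNIV. cnj (U $ k $ i) * U $ k $ j) = (if i = j then 1 else 0)" for i j
    using assms
    by (auto simp: unitary_matrix_def conj_transpose_def matrix_matrix_mult_def mat_def vec_eq_iff)
  have "transpose ?A ** ?A + transpose ?B ** ?B = mat 1"
    using arg_cong[OF eq, of Re]
    by (simp add: Re_mat_def Im_mat_def transpose_def matrix_matrix_mult_def mat_def vec_eq_iff
        sum.distrib)
  moreover from this have "- (transpose ?B ** ?B) - transpose ?A ** ?A = - mat 1"
    by (simp flip: minus_add_distrib add: algebra_simps)
  moreover have "transpose ?A ** ?B = transpose ?B ** ?A"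
    using arg_cong[OF eq, of Im]
    by (simp add: Re_mat_def Im_mat_def transpose_def matrix_matrix_mult_def mat_def vec_eq_iff
        sum.distrib sum_subtractf sum_negf algebra_simps if_distrib cong: if_cong)
  ultimately show ?thesis
    by (simp add: Sp_def R_mat_def J_mat_def block_simps add.commute)
qed

text \<open>Hence the requirement \<open>M \<in> Sp\<close> in \<open>metaplectic\<close> does not restrict these products.\<close>

lemma VDR_in_Sp:
  assumes "transpose Q = Q" "invertible L" "unitary_matrix U"
  shows "V_mat Q ** D_mat L ** R_mat U \<in> Sp"
  by (intro Sp_mult V_mat_in_Sp D_mat_in_Sp R_mat_in_Sp assms)

end

theory Submission
  imports Defs "HOL-Probability.Levy"
begin

text \<open>
  Write \<open>M\<^sub>\<omega>\<close> for the modulation \<open>h \<mapsto> e\<^sup>2\<^sup>\<pi>\<^sup>i\<^sup>\<omega>\<^sup>\<cdot>\<^sup>t h\<close>, that is \<open>\<rho>(0, \<omega>)\<close>. If \<open>A z = (0, \<omega>)\<close>, then \<open>T\<close>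
  carries the one-parameter group \<open>\<rho>(s z)\<close> to the modulations \<open>M\<^bsub>s\<omega>\<^esub>\<close>, and therefore carries any
  average \<open>\<integral> k(s) \<rho>(s z) F ds\<close> to the pointwise product of \<open>T F\<close> with the function
  \<open>\<integral> k(s) e\<^sup>2\<^sup>\<pi>\<^sup>i\<^sup>s\<^sup>\<omega>\<^sup>\<cdot>\<^sup>t ds\<close> of \<open>t\<close>. For the Fejer kernel \<open>k\<close> this function is a tent in \<open>\<omega> \<cdot> t\<close>, which vanishes
  outside a slab (\<open>metaplectic_fejer_mean_modulation\<close>). Averaging successively along vectors \<open>z\<close>
  whose frequencies \<open>\<omega>\<close> span the whole space cuts \<open>T F\<close> down to an intersection of slabs, which is
  compact.

  The averages have to preserve tensor products. They do if \<open>z\<close> is a phase-space shift of only one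
  of the two tensor factors. The vectors \<open>z\<close> with \<open>A z \<in> 0 \<times> \<real>\<^sup>2\<^sup>d\<close> form a Lagrangian plane, the
  preimage of the vertical plane. In the complex coordinates \<open>v = x - i\<xi>\<close> of \<open>z = (x, \<xi>)\<close> it is
  \<open>{v. Re (U v) = 0}\<close>, and as \<open>U\<close> is unitary this condition reads \<open>U\<^sup>tU v = - cnj v\<close>. When
  \<open>U\<^sup>tU\<close> is block-diagonal, the condition holds for \<open>v\<close> iff it holds for the two halves of \<open>v\<close>
  separately. So the plane is the direct sum of a plane of shifts of the first factor and a plane
  of shifts of the second factor, and the frequencies that belong to these two kinds of shifts span
  \<open>\<real>\<^sup>2\<^sup>d\<close> (\<open>adapted_spanning\<close>).

  Start with any nonzero tensor product \<open>F\<close> of bounded integrable functions. If the frequencies are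
  scaled by a small \<open>r > 0\<close>, the slabs become wide, and as \<open>r \<rightarrow> 0\<close> the product of the tents tends
  to \<open>1\<close> at each point. Since \<open>T F \<noteq> 0\<close>, the cut-off image is nonzero for some \<open>r\<close>. It is the image
  of a tensor product, whose factors are then nonzero as well.
\<close>

section \<open>The Fejer kernel and its Fourier transform\<close>

text \<open>
  The normalisation makes the Fourier transform equal to \<open>1\<close> at the origin. At \<open>s = 0\<close> the value is
  the junk value \<open>0\<close> instead of \<open>1 / (2\<pi>)\<close>, which no integral notices.
\<close>

definition fejer :: "real \<Rightarrow> real"
  where "fejer s = (1 - cos s) / (pi * s\<^sup>2)"

lemma fejer_measurable [measurable]: "fejer \<in> borel_measurable borel"
  unfolding fejer_def by measurable

text \<open>
  The kernel is bounded near \<open>0\<close> because \<open>1 - cos s \<le> s\<^sup>2 / 2\<close>, and \<open>1 - cos s \<le> 2\<close> makes it decay like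
  \<open>s\<^sup>-\<^sup>2\<close>. Multiplying the second bound by \<open>s\<^sup>2\<close> and adding the first one compares the kernel with
  \<open>1 / (1 + s\<^sup>2)\<close>.
\<close>

lemma integrable_fejer: "integrable lborel fejer"
proof (rule Bochner_Integration.integrable_bound)
  show "integrable lborel (\<lambda>s::real. 5 / (2 * pi) * inverse (1 + s\<^sup>2))"
    using integrable_inverse_1_plus_square by (simp add: set_integrable_def)
  show "AE s in lborel. norm (fejer s) \<le> norm (5 / (2 * pi) * inverse (1 + s\<^sup>2))"
  proof (rule AE_I2)
    fix s :: real
    have "1 - cos s = 2 * (sin (s / 2))\<^sup>2"
      using cos_double_sin[of "s / 2"] by simp
    moreover have "(sin (s / 2))\<^sup>2 \<le> (s / 2)\<^sup>2"
      using abs_sin_x_le_abs_x[of "s / 2"] by (rule abs_le_square_iff[THEN iffD1])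
    ultimately have 1: "1 - cos s \<le> s\<^sup>2 / 2"
      by (simp add: power_divide)
    have "(1 - cos s) * s\<^sup>2 \<le> 2 * s\<^sup>2"
      using cos_ge_minus_one[of s] by (intro mult_right_mono) (linarith, simp)
    with 1 have 2: "(1 - cos s) * (1 + s\<^sup>2) \<le> 5 / 2 * s\<^sup>2"
      by (simp add: algebra_simps)
    have "fejer s \<le> 5 / (2 * pi) * inverse (1 + s\<^sup>2)"
    proof (cases "s = 0")
      case False
      have "0 < 1 + s\<^sup>2" by (simp add: add_pos_nonneg)
      with False 2 show ?thesis
        unfolding fejer_def by (simp add: divide_simps) (simp add: algebra_simps)
    qed (simp add: fejer_def)
    moreover have "0 \<le> fejer s"
      by (simp add: fejer_def)
    ultimately show "norm (fejer s) \<le> norm (5 / (2 * pi) * inverse (1 + s\<^sup>2))"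
      by simp
  qed
qed simp

definition tent :: "real \<Rightarrow> real"
  where "tent u = max 0 (1 - \<bar>u\<bar>)"

lemma char_uniform_01:
  assumes "t \<noteq> 0"
  shows "char (uniform_measure lborel {0..1}) t = (iexp t - 1) / (\<i> * t)"
proof -
  have "uniform_measure lborel {0..1::real} = density lborel (\<lambda>x. ennreal (indicator {0..1} x))"
    by (simp add: uniform_measure_def ennreal_indicator divide_ennreal_def)
  then have "char (uniform_measure lborel {0..1}) t = (CLINT x|lborel. indicator {0..1} x *\<^sub>R iexp (t * x))"
    unfolding char_def by (simp only:) (subst integral_density, auto)
  also have "\<dots> = (CLBINT x=ereal 0..ereal 1. iexp (t * x))"
    by (subst interval_integral_Icc) (auto simp: set_lebesgue_integral_def)
  also have "\<dots> = iexp (t * 1) / (\<i> * t) - iexp (t * 0) / (\<i> * t)"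
    using assms
    by (subst interval_integral_FTC_finite [where F = "\<lambda>x. iexp (t * x) / (\<i> * t)"])
       (auto intro!: derivative_eq_intros continuous_intros simp: has_vector_derivative_complex_iff Re_exp Im_exp
         Re_divide Im_divide power2_eq_square)
  finally show ?thesis using assms by (simp add: diff_divide_distrib)
qed

text \<open>
  Levy's inversion formula for the uniform distribution on \<open>[0, 1]\<close>, with characteristic function
  \<open>\<phi>(t) = (e\<^sup>i\<^sup>t - 1) / (it)\<close>, and the interval \<open>(-u, 1 - u]\<close>. Its integrand is \<open>e\<^sup>i\<^sup>t\<^sup>u\<close> times
  \<open>(1 - e\<^sup>-\<^sup>i\<^sup>t) / (it) \<cdot> \<phi>(t) = 2 (1 - cos t) / t\<^sup>2\<close>, the Fejer kernel up to the factor \<open>2\<pi>\<close>. The measure of the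
  interval is the length of \<open>[0, 1] \<inter> (-u, 1 - u]\<close>, the tent. As the kernel is integrable, the
  principal value in the inversion formula is an ordinary integral.
\<close>

lemma fourier_fejer: "(CLINT s|lborel. fejer s * iexp (s * u)) = tent u"
proof -
  let ?M = "uniform_measure lborel {0..1::real}"
  interpret M: prob_space ?M
    by (rule prob_space_uniform_measure) auto
  interpret M: real_distribution ?M
    by unfold_locales simp
  have meas: "measure ?M B = measure lborel ({0..1} \<inter> B)" if "B \<in> sets borel" for B
    using that by (subst measure_uniform_measure) auto
  have atom: "measure ?M {a} = 0" for a
    by (auto simp: meas Int_insert_right)
  let ?F = "\<lambda>t. (iexp (-(t * (-u))) - iexp (-(t * (1 - u)))) / (\<i> * t) * char ?M t"
  \<comment> \<open>The integrand of the inversion formula is the Fejer kernel off the null set \<open>{0}\<close>.\<close>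
  have F: "?F t = (2 * pi) * (fejer t * iexp (t * u))" if "t \<noteq> 0" for t
  proof -
    have "iexp (-(t * (1 - u))) = iexp (t * u) * iexp (- t)"
      by (simp add: exp_add[symmetric] algebra_simps)
    then have "?F t = iexp (t * u) * ((1 - iexp (- t)) * (iexp t - 1) / (- (t\<^sup>2)))"
      using that by (simp add: char_uniform_01 field_simps power2_eq_square)
    also have "(1 - iexp (- t)) * (iexp t - 1) = iexp t + iexp (- t) - 2"
      by (simp add: algebra_simps exp_add[symmetric])
    also have "\<dots> = - (2 * (1 - cos t))"
      by (simp add: complex_eq_iff Re_exp Im_exp cos_of_real)
    also have "iexp (t * u) * (complex_of_real (- (2 * (1 - cos t))) / complex_of_real (- (t\<^sup>2))) = (2 * pi) * (fejer t * iexp (t * u))"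
      using that by (simp add: fejer_def field_simps)
    finally show ?thesis .
  qed
  have int: "integrable lborel (\<lambda>s. fejer s * iexp (s * u))"
    using integrable_fejer
    by (rule Bochner_Integration.integrable_bound) (auto simp: norm_mult)
  have "(\<lambda>T. 1 / (2 * pi) * (CLBINT t=-real T..real T. ?F t))
    \<longlonglongrightarrow> complex_of_real (measure ?M {-u<..1-u})"
    using M.Levy_Inversion[of "-u" "1-u"] atom by simp
  moreover have "1 / (2 * pi) * (CLBINT t=-real T..real T. ?F t)
      = (CLINT s|lborel. indicator {-real T<..<real T} s *\<^sub>R (fejer s * iexp (s * u)))" for T
  proof -
    have "(CLBINT t=-real T..real T. ?F t) = (CLINT t|lborel. indicator {-real T<..<real T} t *\<^sub>R ?F t)"
      by (simp add: interval_lebesgue_integral_def set_lebesgue_integral_def)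
    also have "\<dots> = (CLINT t|lborel. (2 * pi) * (indicator {-real T<..<real T} t *\<^sub>R (fejer t * iexp (t * u))))"
    proof (rule integral_cong_AE)
      have "AE t::real in lborel. t \<noteq> 0" by (rule AE_lborel_singleton)
      then show "AE t in lborel. indicator {-real T<..<real T} t *\<^sub>R ?F t
          = (2 * pi) * (indicator {-real T<..<real T} t *\<^sub>R (fejer t * iexp (t * u)))"
        by eventually_elim (subst F, auto)
    qed measurable
    also have "\<dots> = (2 * pi) * (CLINT s|lborel. indicator {-real T<..<real T} s *\<^sub>R (fejer s * iexp (s * u)))"
      by (rule integral_mult_right_zero)
    finally show ?thesis by (simp only:) simp
  qed
  moreover have "(\<lambda>T. CLINT s|lborel. indicator {-real T<..<real T} s *\<^sub>R (fejer s * iexp (s * u)))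
    \<longlonglongrightarrow> (CLINT s|lborel. fejer s * iexp (s * u))"
  proof (rule integral_dominated_convergence)
    show "integrable lborel (\<lambda>s. norm (fejer s * iexp (s * u)))"
      using int by (rule integrable_norm)
    show "AE s in lborel. (\<lambda>T. indicator {-real T<..<real T} s *\<^sub>R (fejer s * iexp (s * u)))
       \<longlonglongrightarrow> fejer s * iexp (s * u)"
    proof (rule AE_I2)
      fix s :: real
      have "eventually (\<lambda>T. \<bar>s\<bar> < real T) sequentially"
        using reals_Archimedean2[of "\<bar>s\<bar>"] by (metis eventually_sequentiallyI of_nat_le_iff order_less_le_trans)
      then show "(\<lambda>T. indicator {-real T<..<real T} s *\<^sub>R (fejer s * iexp (s * u)))
       \<longlonglongrightarrow> fejer s * iexp (s * u)"
        by (intro tendsto_eventually) (auto elim!: eventually_mono simp: abs_less_iff)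
    qed
  qed (auto split: split_indicator)
  ultimately have "(CLINT s|lborel. fejer s * iexp (s * u)) = measure ?M {-u<..1-u}"
    by (simp add: LIMSEQ_unique)
  also have "measure ?M {-u<..1-u} = tent u"
  proof -
    have "measure ?M {-u<..1-u} = measure lborel ({0..1} \<inter> {-u<..1-u})"
      by (simp add: meas)
    also have "\<dots> = tent u"
    proof (cases "u \<ge> 0")
      case True
      then have "{0..1} \<inter> {-u<..1-u} = (if u = 0 then {0<..1} else {0..1-u})"
        by auto
      then show ?thesis using True by (simp add: tent_def)
    next
      case False
      then have "{0..1} \<inter> {-u<..1-u} = {-u<..1}"
        by auto
      then show ?thesis using False by (cases "- u \<le> 1") (auto simp: tent_def)
    qed
    finally show ?thesis .
  qed
  finally show ?thesis .
qed

lemma tent_measurable [measurable]: "tent \<in> borel_measurable borel"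
  unfolding tent_def by measurable

lemma tent_bounds: "0 \<le> tent u" "tent u \<le> 1"
  by (auto simp: tent_def)

section \<open>The two halves of a vector\<close>

definition stack :: "'a ^ 'n \<Rightarrow> 'a ^ 'n \<Rightarrow> 'a ^ ('n::finite + 'n)"
  where "stack a b = (\<chi> i. case i of Inl k \<Rightarrow> a $ k | Inr k \<Rightarrow> b $ k)"

lemma fst_half_stack [simp]: "fst_half (stack a b) = a"
  and snd_half_stack [simp]: "snd_half (stack a b) = b"
  by (simp_all add: fst_half_def snd_half_def stack_def vec_eq_iff)

lemma stack_halves [simp]: "stack (fst_half z) (snd_half z) = z"
  by (auto simp: fst_half_def snd_half_def stack_def vec_eq_iff split: sum.splits)

lemma scaleR_stack: "c *\<^sub>R stack a b = stack (c *\<^sub>R a) (c *\<^sub>R b)"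
  by (auto simp: stack_def vec_eq_iff split: sum.splits)

lemma add_stack: "stack a b + stack c d = stack (a + c) (b + d)"
  by (auto simp: stack_def vec_eq_iff split: sum.splits)

lemma fst_half_scaleR [simp]: "fst_half (c *\<^sub>R z) = c *\<^sub>R fst_half z"
  and snd_half_scaleR [simp]: "snd_half (c *\<^sub>R z) = c *\<^sub>R snd_half z"
  by (simp_all add: fst_half_def snd_half_def vec_eq_iff)

lemma inner_halves:
  fixes a b :: "real ^ ('n::finite + 'n)"
  shows "a \<bullet> b = fst_half a \<bullet> fst_half b + snd_half a \<bullet> snd_half b"
  by (simp add: inner_vec_def sum_UNIV_Plus fst_half_def snd_half_def)

lemma block_vec_mult:
  fixes A B C D :: "'a::semiring_1 ^ 'n::finite ^ 'n"
  shows "block A B C D *v stack x y = stack (A *v x + B *v y) (C *v x + D *v y)"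
  by (auto simp: block_def stack_def matrix_vector_mult_def vec_eq_iff sum_UNIV_Plus split: sum.splits)

section \<open>Square-integrable functions\<close>

lemma cnj_measurable [measurable]: "cnj \<in> borel_measurable borel"
  by (intro borel_measurable_continuous_onI continuous_intros)

lemma L2_measurable: "f \<in> L2 \<Longrightarrow> f \<in> borel_measurable borel"
  by (simp add: L2_def)

lemma L2_integrable_sq: "f \<in> L2 \<Longrightarrow> integrable lborel (\<lambda>x. (cmod (f x))\<^sup>2)"
  by (simp add: L2_def)

lemma L2_integrable_mult:
  assumes "f \<in> L2" "g \<in> L2"
  shows "integrable lborel (\<lambda>x. f x * cnj (g x))"
proof (rule Bochner_Integration.integrable_bound)
  note [measurable] = assms[THEN L2_measurable]
  show "integrable lborel (\<lambda>x. (cmod (f x))\<^sup>2 + (cmod (g x))\<^sup>2)"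
    using assms by (intro Bochner_Integration.integrable_add L2_integrable_sq)
  show "(\<lambda>x. f x * cnj (g x)) \<in> borel_measurable lborel"
    by measurable
  have "a * b \<le> a\<^sup>2 + b\<^sup>2" if "0 \<le> a" "0 \<le> b" for a b :: real
    using sum_squares_bound[of a b] mult_nonneg_nonneg[OF that] by linarith
  then show "AE x in lborel. norm (f x * cnj (g x)) \<le> norm ((cmod (f x))\<^sup>2 + (cmod (g x))\<^sup>2)"
    by (simp add: norm_mult)
qed

lemma L2_diff:
  assumes "f \<in> L2" "g \<in> L2"
  shows "(\<lambda>x. f x - g x) \<in> L2"
proof -
  note [measurable] = assms[THEN L2_measurable]
  have "integrable lborel (\<lambda>x. (cmod (f x - g x))\<^sup>2)"
  proof (rule Bochner_Integration.integrable_bound)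
    show "integrable lborel (\<lambda>x. 2 * (cmod (f x))\<^sup>2 + 2 * (cmod (g x))\<^sup>2)"
      using assms by (intro Bochner_Integration.integrable_add integrable_mult_right L2_integrable_sq)
    have "(cmod (a - b))\<^sup>2 \<le> 2 * (cmod a)\<^sup>2 + 2 * (cmod b)\<^sup>2" for a b
    proof -
      have "(cmod (a - b))\<^sup>2 \<le> (cmod a + cmod b)\<^sup>2"
        by (intro power_mono norm_triangle_ineq4) simp
      also have "\<dots> \<le> 2 * (cmod a)\<^sup>2 + 2 * (cmod b)\<^sup>2"
        using sum_squares_bound[of "cmod a" "cmod b"] by (simp add: power2_sum)
      finally show ?thesis .
    qed
    then show "AE x in lborel. norm ((cmod (f x - g x))\<^sup>2) \<le> norm (2 * (cmod (f x))\<^sup>2 + 2 * (cmod (g x))\<^sup>2)"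
      by simp
  qed measurable
  then show ?thesis by (simp add: L2_def)
qed

lemma L2_inner_diff_left:
  assumes "f \<in> L2" "g \<in> L2" "h \<in> L2"
  shows "L2_inner (\<lambda>x. f x - g x) h = L2_inner f h - L2_inner g h"
  unfolding L2_inner_def left_diff_distrib
  using assms by (intro Bochner_Integration.integral_diff L2_integrable_mult)

lemma L2_inner_cong:
  assumes "f \<in> L2" "f' \<in> L2" "g \<in> L2" "g' \<in> L2" "ae_eq f f'" "ae_eq g g'"
  shows "L2_inner f g = L2_inner f' g'"
proof -
  note [measurable] = assms(1-4)[THEN L2_measurable]
  show ?thesis
    unfolding L2_inner_def
  proof (rule integral_cong_AE)
    show "AE x in lborel. f x * cnj (g x) = f' x * cnj (g' x)"
      using assms(5,6) unfolding ae_eq_def by eventually_elim simp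
  qed measurable
qed

lemma L2_inner_self_eq_0:
  assumes "h \<in> L2"
  shows "L2_inner h h = 0 \<longleftrightarrow> ae_eq h (\<lambda>_. 0)"
proof -
  note [measurable] = L2_measurable[OF assms]
  have "L2_inner h h = of_real (LINT x|lborel. (cmod (h x))\<^sup>2)"
    unfolding L2_inner_def by (simp flip: integral_complex_of_real add: complex_norm_square[symmetric])
  then show ?thesis
    unfolding ae_eq_def
    by (simp add: integral_nonneg_eq_0_iff_AE[OF L2_integrable_sq[OF assms]])
qed

lemma L2_unitary_ae_zero_iff:
  assumes "L2_unitary T" "f \<in> L2"
  shows "ae_eq (T f) (\<lambda>_. 0) \<longleftrightarrow> ae_eq f (\<lambda>_. 0)"
  using assms by (simp add: L2_unitary_def flip: L2_inner_self_eq_0)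

text \<open>
  A class inside \<open>L\<^sup>2\<close> that is closed under averaging of time-frequency shifts and under tensor
  products, with averages that exist pointwise everywhere. This avoids Bochner integrals with
  values in \<open>L\<^sup>2\<close>.
\<close>

definition bounded_L1 :: "('a::euclidean_space \<Rightarrow> complex) set"
  where "bounded_L1 = {f. integrable lborel f \<and> bounded (range f)}"

lemma bounded_L1_imp_L2:
  assumes "f \<in> bounded_L1"
  shows "f \<in> L2"
proof -
  have int: "integrable lborel f"
    using assms by (simp add: bounded_L1_def)
  then have [measurable]: "f \<in> borel_measurable borel"
    using borel_measurable_integrable by force
  obtain C where C: "\<And>x. cmod (f x) \<le> C"
    using assms by (auto simp: bounded_L1_def bounded_iff)
  have "integrable lborel (\<lambda>x. (cmod (f x))\<^sup>2)"
  proof (rule Bochner_Integration.integrable_bound)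
    show "integrable lborel (\<lambda>x. C * f x)"
      using int by simp
    have "0 \<le> C" using C[of 0] norm_ge_zero[of "f 0"] by linarith
    then show "AE x in lborel. norm ((cmod (f x))\<^sup>2) \<le> norm (C * f x)"
      using C by (auto simp: power2_eq_square norm_mult intro!: mult_right_mono)
  qed measurable
  then show ?thesis by (simp add: L2_def)
qed

lemma bounded_L1_measurable: "f \<in> bounded_L1 \<Longrightarrow> f \<in> borel_measurable borel"
  using borel_measurable_integrable by (force simp: bounded_L1_def)

section \<open>Fejer means of time-frequency shifts\<close>

lemma norm_tf_shift: "cmod (tf_shift z f t) = cmod (f (t - fst_half z))"
proof -
  have "cmod (exp (- \<i> * pi * (fst_half z \<bullet> snd_half z))) = 1"
    using norm_exp_i_times[of "- (pi * (fst_half z \<bullet> snd_half z))"] by simp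
  moreover have "cmod (exp (2 * pi * \<i> * (snd_half z \<bullet> t))) = 1"
    using norm_exp_i_times[of "2 * pi * (snd_half z \<bullet> t)"] by (simp add: mult_ac)
  ultimately show ?thesis
    by (simp add: tf_shift_def Let_def norm_mult)
qed

lemma tf_shift_measurable [measurable (raw)]:
  assumes [measurable]: "f \<in> borel_measurable borel" "c \<in> borel_measurable M" "t \<in> borel_measurable M"
  shows "(\<lambda>x. tf_shift (c x *\<^sub>R z) f (t x)) \<in> borel_measurable M"
  unfolding tf_shift_def Let_def fst_half_scaleR snd_half_scaleR by measurable

lemma integrable_translation:
  fixes c :: "'a::euclidean_space" and f :: "'a \<Rightarrow> 'b::{banach, second_countable_topology}"
  assumes "integrable lborel f"
  shows "integrable lborel (\<lambda>x. f (x - c))"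
    and "(LINT x|lborel. f (x - c)) = (LINT x|lborel. f x)"
proof -
  have [measurable]: "f \<in> borel_measurable borel"
    using borel_measurable_integrable[OF assms] by simp
  show "integrable lborel (\<lambda>x. f (x - c))"
    using integrable_distr[of "(+) (- c)" lborel borel f] assms
    by (simp add: lborel_distr_plus)
  show "(LINT x|lborel. f (x - c)) = (LINT x|lborel. f x)"
    using integral_distr[of "(+) (- c)" lborel borel f]
    by (simp add: lborel_distr_plus)
qed

lemma tf_shift_L2:
  assumes "f \<in> L2"
  shows "tf_shift z f \<in> L2"
    and "(LINT t|lborel. (cmod (tf_shift z f t))\<^sup>2) = (LINT t|lborel. (cmod (f t))\<^sup>2)"
proof -
  have [measurable]: "f \<in> borel_measurable borel"
    by (rule L2_measurable[OF assms])
  \<comment> \<open>The factor \<open>1\<close> brings the shift into the form \<open>s *\<^sub>R z\<close> of the measurability rule.\<close>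
  have "(\<lambda>t. tf_shift (1 *\<^sub>R z) f t) \<in> borel_measurable borel"
    by measurable
  then show "tf_shift z f \<in> L2"
    using integrable_translation[OF L2_integrable_sq[OF assms]]
    by (simp add: L2_def norm_tf_shift)
  show "(LINT t|lborel. (cmod (tf_shift z f t))\<^sup>2) = (LINT t|lborel. (cmod (f t))\<^sup>2)"
    using integrable_translation[OF L2_integrable_sq[OF assms]]
    by (simp add: norm_tf_shift)
qed

text \<open>
  The Fubini criterion for Fejer means: the kernel is integrable, so it suffices that the \<open>L\<^sup>1\<close> norms
  in \<open>t\<close> are bounded uniformly in \<open>s\<close>.
\<close>

lemma integrable_fejer_mult:
  fixes \<Phi> :: "real \<times> 'a::euclidean_space \<Rightarrow> complex"
  assumes [measurable]: "\<Phi> \<in> borel_measurable (borel \<Otimes>\<^sub>M borel)"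
    and int: "\<And>s. integrable lborel (\<lambda>t. \<Phi> (s, t))"
    and bound: "\<And>s. (LINT t|lborel. cmod (\<Phi> (s, t))) \<le> C"
  shows "integrable (lborel \<Otimes>\<^sub>M lborel) (\<lambda>(s, t). fejer s * \<Phi> (s, t))"
proof (rule lborel_pair.Fubini_integrable)
  show "integrable lborel (\<lambda>s. LINT t|lborel. norm (case (s, t) of (s, t) \<Rightarrow> fejer s * \<Phi> (s, t)))"
  proof (rule Bochner_Integration.integrable_bound)
    show "integrable lborel (\<lambda>s. C * fejer s)"
      using integrable_fejer by simp
    have "\<bar>fejer s\<bar> * (LINT t|lborel. cmod (\<Phi> (s, t))) \<le> \<bar>fejer s\<bar> * \<bar>C\<bar>" for s
      by (intro mult_left_mono order_trans[OF bound]) auto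
    then show "AE s in lborel. norm (LINT t|lborel. norm (case (s, t) of (s, t) \<Rightarrow> fejer s * \<Phi> (s, t)))
        \<le> norm (C * fejer s)"
      by (simp add: norm_mult abs_mult mult.commute)
  qed measurable
  show "AE s in lborel. integrable lborel (\<lambda>t. case (s, t) of (s, t) \<Rightarrow> fejer s * \<Phi> (s, t))"
    using int by simp
qed measurable

definition fejer_mean ::
    "real ^ ('n::finite + 'n) \<Rightarrow> (real ^ 'n \<Rightarrow> complex) \<Rightarrow> real ^ 'n \<Rightarrow> complex"
  where "fejer_mean z f t = (CLINT s|lborel. fejer s * tf_shift (s *\<^sub>R z) f t)"

text \<open>
  Time-frequency shifts preserve both the supremum and the \<open>L\<^sup>1\<close> norm, so the average over the
  integrable kernel increases either by at most the factor \<open>\<integral> k\<close>.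
\<close>

lemma fejer_mean_bounded_L1:
  assumes "f \<in> bounded_L1"
  shows "fejer_mean z f \<in> bounded_L1"
proof -
  have int: "integrable lborel f"
    using assms by (simp add: bounded_L1_def)
  then have [measurable]: "f \<in> borel_measurable borel"
    using borel_measurable_integrable by force
  obtain C where C: "\<And>x. cmod (f x) \<le> C"
    using assms by (auto simp: bounded_L1_def bounded_iff)
  have meas: "(\<lambda>t. tf_shift (s *\<^sub>R z) f t) \<in> borel_measurable lborel" for s
    by measurable
  have "integrable lborel (\<lambda>t. tf_shift (s *\<^sub>R z) f t)" for s
    by (rule Bochner_Integration.integrable_bound[OF integrable_translation(1)[OF int, of "s *\<^sub>R fst_half z"] meas])
       (simp add: norm_tf_shift)
  moreover have "(LINT t|lborel. cmod (tf_shift (s *\<^sub>R z) f t)) \<le> (LINT t|lborel. cmod (f t))" for s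
    using integrable_translation(2)[OF integrable_norm[OF int]]
    by (simp add: norm_tf_shift)
  ultimately have "integrable (lborel \<Otimes>\<^sub>M lborel)
      (\<lambda>(s, t). fejer s * (\<lambda>(s, t). tf_shift (s *\<^sub>R z) f t) (s, t))"
    by (intro integrable_fejer_mult) auto
  then have "integrable lborel (fejer_mean z f)"
    unfolding fejer_mean_def using lborel_pair.integrable_snd by (simp add: split_beta')
  moreover have "cmod (fejer_mean z f t) \<le> (LINT s|lborel. C * fejer s)" for t
  proof -
    have *: "norm (fejer s * tf_shift (s *\<^sub>R z) f t) \<le> C * fejer s" for s
    proof -
      have "0 \<le> fejer s" by (simp add: fejer_def)
      then show ?thesis using C
        by (simp add: norm_mult norm_tf_shift mult.commute[of C] mult_left_mono)
    qed
    have C_int: "integrable lborel (\<lambda>s. C * fejer s)"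
      using integrable_fejer by simp
    have "integrable lborel (\<lambda>s. fejer s * tf_shift (s *\<^sub>R z) f t)"
    proof (rule Bochner_Integration.integrable_bound[OF C_int])
      show "AE s in lborel. norm (fejer s * tf_shift (s *\<^sub>R z) f t) \<le> norm (C * fejer s)"
        using order_trans[OF * abs_ge_self] by simp
    qed measurable
    then show ?thesis
      unfolding fejer_mean_def using C_int * by (rule Bochner_Integration.integral_norm_bound_integral)
  qed
  ultimately show ?thesis
    by (auto simp: bounded_L1_def bounded_iff)
qed

text \<open>
  The mean is the weak integral of \<open>k(s) \<rho>(s z) f\<close> in \<open>L\<^sup>2\<close>. The exchange of integrals is justified since
  \<open>\<rho>(s z) f\<close> has the same \<open>L\<^sup>2\<close> norm for all \<open>s\<close>.
\<close>

lemma L2_inner_fejer_mean: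
  assumes "f \<in> L2" "h \<in> L2"
  shows "L2_inner (fejer_mean z f) h = (CLINT s|lborel. fejer s * L2_inner (tf_shift (s *\<^sub>R z) f) h)"
proof -
  note [measurable] = assms[THEN L2_measurable]
  let ?\<Phi> = "\<lambda>(s, t). tf_shift (s *\<^sub>R z) f t * cnj (h t)"
  let ?C = "(LINT t|lborel. (cmod (f t))\<^sup>2) + (LINT t|lborel. (cmod (h t))\<^sup>2)"
  have "(LINT t|lborel. cmod (?\<Phi> (s, t))) \<le> ?C" for s
  proof -
    have f: "tf_shift (s *\<^sub>R z) f \<in> L2"
      by (rule tf_shift_L2[OF assms(1)])
    have *: "a * b \<le> a\<^sup>2 + b\<^sup>2" if "0 \<le> a" "0 \<le> b" for a b :: real
      using sum_squares_bound[of a b] mult_nonneg_nonneg[OF that] by linarith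
    have "(LINT t|lborel. cmod (?\<Phi> (s, t)))
        \<le> (LINT t|lborel. (cmod (tf_shift (s *\<^sub>R z) f t))\<^sup>2 + (cmod (h t))\<^sup>2)"
      using L2_integrable_mult[OF f assms(2), THEN integrable_norm]
      by (intro integral_mono Bochner_Integration.integrable_add L2_integrable_sq f assms(2))
         (auto simp: norm_mult intro!: *)
    also have "\<dots> = ?C"
      using f assms tf_shift_L2(2)[OF assms(1)] by (simp add: L2_integrable_sq)
    finally show ?thesis .
  qed
  moreover have "integrable lborel (\<lambda>t. ?\<Phi> (s, t))" for s
    using L2_integrable_mult[OF tf_shift_L2(1)[OF assms(1)] assms(2)] by simp
  ultimately have int: "integrable (lborel \<Otimes>\<^sub>M lborel) (\<lambda>(s, t). fejer s * ?\<Phi> (s, t))"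
    by (intro integrable_fejer_mult) auto
  have "L2_inner (fejer_mean z f) h = (CLINT t|lborel. CLINT s|lborel. fejer s * ?\<Phi> (s, t))"
    unfolding L2_inner_def fejer_mean_def by (simp flip: integral_mult_left_zero add: mult.assoc)
  also have "\<dots> = (CLINT s|lborel. CLINT t|lborel. fejer s * ?\<Phi> (s, t))"
    using int by (intro lborel_pair.Fubini_integral) simp
  also have "\<dots> = (CLINT s|lborel. fejer s * L2_inner (tf_shift (s *\<^sub>R z) f) h)"
    unfolding L2_inner_def by simp
  finally show ?thesis .
qed

text \<open>
  Along a purely vertical vector the shifts are modulations, so the average multiplies by the
  Fourier transform of the kernel.
\<close>

lemma fejer_mean_modulation: "fejer_mean (stack 0 \<omega>) f t = complex_of_real (tent (2 * pi * (\<omega> \<bullet> t))) * f t"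
proof -
  have "fejer_mean (stack 0 \<omega>) f t = (CLINT s|lborel. (fejer s * iexp (s * (2 * pi * (\<omega> \<bullet> t)))) * f t)"
    unfolding fejer_mean_def tf_shift_def Let_def
    by (intro Bochner_Integration.integral_cong refl) (simp add: mult_ac)
  also have "\<dots> = (CLINT s|lborel. (fejer s * iexp (s * (2 * pi * (\<omega> \<bullet> t))))) * f t"
    by (rule integral_mult_left_zero)
  finally show ?thesis
    by (simp only: fourier_fejer)
qed

lemma tent_mult_L2:
  assumes "f \<in> L2" and [measurable]: "u \<in> borel_measurable borel"
  shows "(\<lambda>t. complex_of_real (tent (u t)) * f t) \<in> L2"
proof -
  note [measurable] = L2_measurable[OF assms(1)]
  have "integrable lborel (\<lambda>t. (cmod (complex_of_real (tent (u t)) * f t))\<^sup>2)"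
  proof (rule Bochner_Integration.integrable_bound[OF L2_integrable_sq[OF assms(1)]])
    have "(tent v * r)\<^sup>2 \<le> r\<^sup>2" if "0 \<le> r" for v r
      using that tent_bounds[of v] by (intro power_mono mult_left_le_one_le) auto
    then show "AE t in lborel. norm ((cmod (complex_of_real (tent (u t)) * f t))\<^sup>2) \<le> norm ((cmod (f t))\<^sup>2)"
      using tent_bounds by (simp add: norm_mult)
  qed measurable
  then show ?thesis by (simp add: L2_def)
qed

section \<open>Metaplectic operators and Fejer means\<close>

text \<open>
  The covariance \<open>T \<rho>(s z) = \<rho>(s A z) T\<close> passes to the averages. For this both sides are tested
  against vectors \<open>T g\<close>: unitarity moves \<open>T\<close> to the other side of the inner product, where the weak
  form of the average applies. As \<open>T\<close> is surjective, the difference of the two sides is itself such a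
  test vector.
\<close>

lemma metaplectic_fejer_mean:
  assumes T: "metaplectic A T"
    and f: "f \<in> L2" "fejer_mean z f \<in> L2" "fejer_mean (A *v z) (T f) \<in> L2"
  shows "ae_eq (T (fejer_mean z f)) (fejer_mean (A *v z) (T f))"
proof -
  have unitary: "L2_unitary T"
    and intertwine: "\<And>w g. g \<in> L2 \<Longrightarrow> ae_eq (tf_shift (A *v w) (T g)) (T (tf_shift w g))"
    using T by (auto simp: metaplectic_def)
  have TL2: "\<And>g. g \<in> L2 \<Longrightarrow> T g \<in> L2"
    and Tinner: "\<And>g h. g \<in> L2 \<Longrightarrow> h \<in> L2 \<Longrightarrow> L2_inner (T g) (T h) = L2_inner g h"
    and Tsurj: "\<And>h. h \<in> L2 \<Longrightarrow> \<exists>g\<in>L2. ae_eq (T g) h"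
    using unitary by (auto simp: L2_unitary_def)
  have inner: "L2_inner (T (fejer_mean z f)) (T g) = L2_inner (fejer_mean (A *v z) (T f)) (T g)"
    if g: "g \<in> L2" for g
  proof -
    have "L2_inner (T (fejer_mean z f)) (T g) = L2_inner (fejer_mean z f) g"
      using f g by (simp add: Tinner)
    also have "\<dots> = (CLINT s|lborel. fejer s * L2_inner (tf_shift (s *\<^sub>R z) f) g)"
      using f g by (simp add: L2_inner_fejer_mean)
    also have "\<dots> = (CLINT s|lborel. fejer s * L2_inner (tf_shift (s *\<^sub>R (A *v z)) (T f)) (T g))"
    proof (intro Bochner_Integration.integral_cong refl)
      fix s
      have "L2_inner (tf_shift (s *\<^sub>R z) f) g = L2_inner (T (tf_shift (s *\<^sub>R z) f)) (T g)"
        using f g by (simp add: Tinner tf_shift_L2)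
      also have "\<dots> = L2_inner (tf_shift (A *v (s *\<^sub>R z)) (T f)) (T g)"
        using f g intertwine[OF f(1), of "s *\<^sub>R z"]
        by (intro L2_inner_cong TL2 tf_shift_L2) (auto simp: ae_eq_def eq_commute)
      finally show "fejer s * L2_inner (tf_shift (s *\<^sub>R z) f) g
          = fejer s * L2_inner (tf_shift (s *\<^sub>R (A *v z)) (T f)) (T g)"
        by (simp add: matrix_vector_mult_scaleR)
    qed
    also have "\<dots> = L2_inner (fejer_mean (A *v z) (T f)) (T g)"
      using f g by (simp add: L2_inner_fejer_mean TL2)
    finally show ?thesis .
  qed
  let ?h = "\<lambda>t. T (fejer_mean z f) t - fejer_mean (A *v z) (T f) t"
  have h: "?h \<in> L2"
    using f by (intro L2_diff TL2)
  then obtain g where g: "g \<in> L2" "ae_eq (T g) ?h"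
    using Tsurj by blast
  have "L2_inner ?h ?h = L2_inner ?h (T g)"
    using g h by (intro L2_inner_cong TL2) (auto simp: ae_eq_def eq_commute)
  also have "\<dots> = 0"
    using f g by (simp add: L2_inner_diff_left TL2 inner)
  finally have "ae_eq ?h (\<lambda>_. 0)"
    using L2_inner_self_eq_0[OF h] by simp
  then show ?thesis
    by (simp add: ae_eq_def)
qed

corollary metaplectic_fejer_mean_modulation:
  assumes "metaplectic A T" "A *v z = stack 0 \<omega>" "f \<in> bounded_L1"
  shows "ae_eq (T (fejer_mean z f)) (\<lambda>t. complex_of_real (tent (2 * pi * (\<omega> \<bullet> t))) * T f t)"
proof -
  have f: "f \<in> L2" "fejer_mean z f \<in> L2"
    using assms(3) by (simp_all add: bounded_L1_imp_L2 fejer_mean_bounded_L1)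
  then have "T f \<in> L2"
    using assms(1) by (simp add: metaplectic_def L2_unitary_def)
  then have "(\<lambda>t. complex_of_real (tent (2 * pi * (\<omega> \<bullet> t))) * T f t) \<in> L2"
    by (intro tent_mult_L2) auto
  moreover have "fejer_mean (A *v z) (T f) = (\<lambda>t. complex_of_real (tent (2 * pi * (\<omega> \<bullet> t))) * T f t)"
    unfolding assms(2) by (rule ext) (rule fejer_mean_modulation)
  ultimately show ?thesis
    using metaplectic_fejer_mean[OF assms(1) f] by simp
qed

section \<open>The vertical Lagrangian plane splits\<close>

definition cnj_vec :: "complex ^ 'n \<Rightarrow> complex ^ 'n"
  where "cnj_vec v = (\<chi> i. cnj (v $ i))"

lemma cnj_vec_cnj_vec [simp]: "cnj_vec (cnj_vec v) = v"
  by (simp add: cnj_vec_def vec_eq_iff)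

lemma transpose_cnj_vec: "transpose U *v cnj_vec w = cnj_vec (conj_transpose U *v w)"
  by (simp add: cnj_vec_def transpose_def conj_transpose_def matrix_vector_mult_def vec_eq_iff)

text \<open>
  Both directions multiply \<open>U v = - cnj (U v)\<close> by the invertible matrix \<open>U\<^sup>t\<close>, using
  \<open>U\<^sup>t cnj (U v) = cnj (U\<^sup>* U v) = cnj v\<close>. The point of the right-hand side is that it depends on \<open>U\<close> only
  through \<open>U\<^sup>tU\<close>.
\<close>

lemma unitary_imaginary_iff:
  assumes "unitary_matrix U"
  shows "U *v v = - cnj_vec (U *v v) \<longleftrightarrow> (transpose U ** U) *v v = - cnj_vec v"
proof -
  have U: "conj_transpose U *v (U *v w) = w" "U *v (conj_transpose U *v w) = w" for w
    using assms by (simp_all add: unitary_matrix_def matrix_vector_mul_assoc)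
  have inj: "a = b" if "transpose U *v a = transpose U *v b" for a b
  proof -
    have "cnj_vec (conj_transpose U *v cnj_vec a) = cnj_vec (conj_transpose U *v cnj_vec b)"
      using that by (simp flip: transpose_cnj_vec)
    then have "U *v (conj_transpose U *v cnj_vec a) = U *v (conj_transpose U *v cnj_vec b)"
      by (metis cnj_vec_cnj_vec)
    then show ?thesis
      unfolding U by (metis cnj_vec_cnj_vec)
  qed
  have "M *v (- w) = - (M *v w)" for M :: "complex ^ 'a ^ 'a" and w
    by (simp add: matrix_vector_mult_def sum_negf vec_eq_iff)
  then have "transpose U *v (- cnj_vec (U *v v)) = - cnj_vec v"
    by (simp add: transpose_cnj_vec U del: transpose_matrix_vector)
  then show ?thesis
    unfolding matrix_vector_mul_assoc[symmetric] using inj by metis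
qed

lemma block_diagonal_stack:
  fixes S :: "complex ^ ('n::finite + 'n) ^ ('n + 'n)"
  assumes "block_diagonal S"
  shows "S *v stack (fst_half v) 0 = stack (fst_half (S *v v)) 0"
    and "S *v stack 0 (snd_half v) = stack 0 (snd_half (S *v v))"
proof -
  obtain S1 S2 where S: "S = block S1 0 0 S2"
    using assms by (auto simp: block_diagonal_def)
  have "S *v v = stack (S1 *v fst_half v) (S2 *v snd_half v)"
    using block_vec_mult[of S1 0 0 S2 "fst_half v" "snd_half v"] by (simp add: S)
  then show "S *v stack (fst_half v) 0 = stack (fst_half (S *v v)) 0"
    and "S *v stack 0 (snd_half v) = stack 0 (snd_half (S *v v))"
    by (simp_all add: S block_vec_mult)
qed

text \<open>
  The minus sign turns the first half \<open>A x + B \<xi>\<close> of \<open>\<R>\<^sub>U (x, \<xi>)\<close>, where \<open>U = A + iB\<close>, into the real part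
  of \<open>U\<close> times this vector.
\<close>

definition phase_vec :: "real ^ 'n \<Rightarrow> real ^ 'n \<Rightarrow> complex ^ 'n"
  where "phase_vec x \<xi> = (\<chi> i. Complex (x $ i) (- \<xi> $ i))"

lemma phase_vec_stack:
  "phase_vec (stack x 0) (stack \<xi> 0) = stack (phase_vec x \<xi>) 0"
  "phase_vec (stack 0 x) (stack 0 \<xi>) = stack 0 (phase_vec x \<xi>)"
  by (auto simp: phase_vec_def stack_def vec_eq_iff complex_eq_iff split: sum.splits)

lemma phase_vec_halves:
  "phase_vec (fst_half x) (fst_half \<xi>) = fst_half (phase_vec x \<xi>)"
  "phase_vec (snd_half x) (snd_half \<xi>) = snd_half (phase_vec x \<xi>)"
  by (simp_all add: phase_vec_def fst_half_def snd_half_def vec_eq_iff)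

text \<open>
  The image is vertical iff \<open>U v\<close> is purely imaginary, where \<open>v\<close> is the complex form of \<open>(x, \<xi>)\<close>.
\<close>

lemma R_mat_vertical_iff:
  assumes "unitary_matrix U"
  shows "fst_half (R_mat U *v stack x \<xi>) = 0
    \<longleftrightarrow> (transpose U ** U) *v phase_vec x \<xi> = - cnj_vec (phase_vec x \<xi>)"
proof -
  have "fst_half (R_mat U *v stack x \<xi>) $ k = Re ((U *v phase_vec x \<xi>) $ k)" for k
    unfolding R_mat_def block_vec_mult fst_half_stack
    by (simp add: Re_mat_def Im_mat_def phase_vec_def
        matrix_vector_mult_def sum.distrib)
  then have "fst_half (R_mat U *v stack x \<xi>) = 0 \<longleftrightarrow> U *v phase_vec x \<xi> = - cnj_vec (U *v phase_vec x \<xi>)"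
    by (simp add: vec_eq_iff complex_eq_iff cnj_vec_def)
  then show ?thesis
    by (simp add: unitary_imaginary_iff[OF assms])
qed

lemma cnj_vec_stack: "cnj_vec (stack a b) = stack (cnj_vec a) (cnj_vec b)"
  and fst_half_cnj_vec: "fst_half (cnj_vec v) = cnj_vec (fst_half v)"
  and snd_half_cnj_vec: "snd_half (cnj_vec v) = cnj_vec (snd_half v)"
  and uminus_stack: "- stack (a::complex ^ 'n::finite) b = stack (- a) (- b)"
  and fst_half_uminus: "fst_half (- v) = - fst_half (v :: complex ^ ('n::finite + 'n))"
  and snd_half_uminus: "snd_half (- v) = - snd_half (v :: complex ^ ('n::finite + 'n))"
  and cnj_vec_0: "cnj_vec 0 = 0"
  by (auto simp: cnj_vec_def stack_def fst_half_def snd_half_def vec_eq_iff split: sum.splits)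

text \<open>
  The vertical condition in the form \<open>U\<^sup>tU v = - cnj v\<close> is inherited by the halves of \<open>v\<close>, because \<open>U\<^sup>tU\<close>
  and complex conjugation both commute with the projections to the halves.
\<close>

lemma R_mat_vertical_halves:
  fixes U :: "complex ^ ('n::finite + 'n) ^ ('n + 'n)"
  assumes U: "unitary_matrix U" and S: "block_diagonal (transpose U ** U)"
    and vertical: "fst_half (R_mat U *v stack x \<xi>) = 0"
  shows "fst_half (R_mat U *v stack (stack (fst_half x) 0) (stack (fst_half \<xi>) 0)) = 0"
    and "fst_half (R_mat U *v stack (stack 0 (snd_half x)) (stack 0 (snd_half \<xi>))) = 0"
  using vertical
  by (simp_all add: R_mat_vertical_iff[OF U] phase_vec_stack phase_vec_halves block_diagonal_stack[OF S]
      cnj_vec_stack fst_half_cnj_vec snd_half_cnj_vec uminus_stack fst_half_uminus snd_half_uminus cnj_vec_0)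

text \<open>
  \<open>M\<^sup>t J M = J\<close> and \<open>J\<^sup>2 = - 1\<close> give the left inverse \<open>- J M\<^sup>t J\<close> of \<open>M\<close>, which is also a right inverse since
  \<open>M\<close> is square.
\<close>

lemma Sp_surj:
  fixes M :: "real ^ ('n::finite + 'n) ^ ('n + 'n)"
  assumes "M \<in> Sp"
  shows "\<exists>z. M *v z = w"
proof -
  have "J_mat ** J_mat = - (mat 1 :: real ^ ('n + 'n) ^ ('n + 'n))"
    unfolding J_mat_def block_simps by (auto simp: block_def vec_eq_iff mat_def split: sum.splits)
  then have "(- (J_mat ** transpose M ** J_mat)) ** M = mat 1"
    using assms by (simp add: Sp_def mult_uminus_left flip: matrix_mul_assoc)
  then have "M ** (- (J_mat ** transpose M ** J_mat)) = mat 1"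
    by (simp add: matrix_left_right_inverse)
  then have "M *v ((- (J_mat ** transpose M ** J_mat)) *v w) = w"
    by (simp add: matrix_vector_mul_assoc)
  then show ?thesis ..
qed

text \<open>
  The lower triangular matrix \<open>\<V>\<^sub>Q \<D>\<^sub>L\<close> is invertible and preserves the vertical plane, so only \<open>\<R>\<^sub>U\<close>
  decides which vectors \<open>A\<close> makes vertical.
\<close>

lemma VDR_fst_half:
  assumes "invertible L"
  shows "fst_half ((V_mat Q ** D_mat L ** R_mat U) *v z) = 0 \<longleftrightarrow> fst_half (R_mat U *v z) = 0"
proof -
  let ?w = "R_mat U *v z"
  have "(V_mat Q ** D_mat L ** R_mat U) *v z = V_mat Q *v (D_mat L *v stack (fst_half ?w) (snd_half ?w))"
    by (simp only: matrix_vector_mul_assoc stack_halves matrix_mul_assoc)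
  then have "fst_half ((V_mat Q ** D_mat L ** R_mat U) *v z) = L *v fst_half ?w"
    by (simp add: V_mat_def D_mat_def block_vec_mult del: stack_halves)
  moreover have "L *v v = 0 \<longleftrightarrow> v = 0" for v
    using assms by (metis invertible_def matrix_vector_mul_assoc matrix_vector_mul_lid matrix_vector_mult_0_right)
  ultimately show ?thesis by simp
qed

text \<open>
  The frequencies \<open>\<omega>\<close> whose modulation corresponds under the metaplectic operator to a time-frequency
  shift of a single tensor factor, the first one or the second one.
\<close>

definition adapted :: "real ^ (('d::finite + 'd) + ('d + 'd)) ^ (('d + 'd) + ('d + 'd)) \<Rightarrow> real ^ ('d + 'd) \<Rightarrow> bool"
  where "adapted A \<omega> \<longleftrightarrow>
    (\<exists>x \<xi>. A *v stack (stack x 0) (stack \<xi> 0) = stack 0 \<omega>) \<or>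
    (\<exists>x \<xi>. A *v stack (stack 0 x) (stack 0 \<xi>) = stack 0 \<omega>)"

lemma adapted_scaleR:
  assumes "adapted A \<omega>"
  shows "adapted A (r *\<^sub>R \<omega>)"
proof -
  have "A *v stack (stack (r *\<^sub>R x) 0) (stack (r *\<^sub>R \<xi>) 0) = stack 0 (r *\<^sub>R \<omega>)"
    if "A *v stack (stack x 0) (stack \<xi> 0) = stack 0 \<omega>" for x \<xi>
    using arg_cong[OF that, of "\<lambda>v. r *\<^sub>R v"] by (simp add: scaleR_stack flip: matrix_vector_mult_scaleR)
  moreover have "A *v stack (stack 0 (r *\<^sub>R x)) (stack 0 (r *\<^sub>R \<xi>)) = stack 0 (r *\<^sub>R \<omega>)"
    if "A *v stack (stack 0 x) (stack 0 \<xi>) = stack 0 \<omega>" for x \<xi>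
    using arg_cong[OF that, of "\<lambda>v. r *\<^sub>R v"] by (simp add: scaleR_stack flip: matrix_vector_mult_scaleR)
  ultimately show ?thesis
    using assms unfolding adapted_def by blast
qed

text \<open>
  Split the preimage \<open>z\<close> of \<open>(0, \<omega>)\<close> into its components in the phase spaces of the two factors: \<open>A\<close>
  maps both to vertical vectors, and their frequencies add up to \<open>\<omega>\<close>.
\<close>

lemma adapted_decomposition:
  fixes Q L :: "real ^ ('d::finite + 'd) ^ ('d + 'd)"
  assumes "transpose Q = Q" "invertible L" "unitary_matrix U" "block_diagonal (transpose U ** U)"
    and A: "A = V_mat Q ** D_mat L ** R_mat U"
  shows "\<exists>\<omega>1 \<omega>2. adapted A \<omega>1 \<and> adapted A \<omega>2 \<and> \<omega> = \<omega>1 + \<omega>2"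
proof -
  have "A \<in> Sp"
    using assms by (simp add: VDR_in_Sp)
  then obtain z where z: "A *v z = stack 0 \<omega>"
    using Sp_surj by blast
  define x where "x = fst_half z"
  define \<xi> where "\<xi> = snd_half z"
  let ?z1 = "stack (stack (fst_half x) 0) (stack (fst_half \<xi>) 0)"
  let ?z2 = "stack (stack 0 (snd_half x)) (stack 0 (snd_half \<xi>))"
  have "fst_half (R_mat U *v stack x \<xi>) = 0"
    using z VDR_fst_half[OF assms(2), of Q U z] by (simp add: A x_def \<xi>_def)
  then have "fst_half (A *v ?z1) = 0" "fst_half (A *v ?z2) = 0"
    unfolding A VDR_fst_half[OF assms(2)] by (rule R_mat_vertical_halves[OF assms(3,4)])+
  then have 1: "A *v ?z1 = stack 0 (snd_half (A *v ?z1))" "A *v ?z2 = stack 0 (snd_half (A *v ?z2))"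
    by (metis stack_halves)+
  have "?z1 + ?z2 = z"
    by (simp add: add_stack x_def \<xi>_def)
  then have "A *v ?z1 + A *v ?z2 = stack 0 \<omega>"
    using z by (simp flip: matrix_vector_right_distrib)
  then have "\<omega> = snd_half (A *v ?z1 + A *v ?z2)"
    by simp
  also have "\<dots> = snd_half (A *v ?z1) + snd_half (A *v ?z2)"
    by (simp add: snd_half_def vec_eq_iff)
  finally show ?thesis
    using 1 unfolding adapted_def by blast
qed

lemma adapted_spanning:
  fixes Q L :: "real ^ ('d::finite + 'd) ^ ('d + 'd)"
  assumes "transpose Q = Q" "invertible L" "unitary_matrix U" "block_diagonal (transpose U ** U)"
    and A: "A = V_mat Q ** D_mat L ** R_mat U"
  shows "\<exists>\<Omega>. finite \<Omega> \<and> (\<forall>\<omega>\<in>\<Omega>. adapted A \<omega>) \<and> span \<Omega> = UNIV"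
proof -
  have "\<forall>\<omega>. \<exists>\<omega>1 \<omega>2. adapted A \<omega>1 \<and> adapted A \<omega>2 \<and> \<omega> = \<omega>1 + \<omega>2"
    using adapted_decomposition[OF assms] by blast
  then obtain p q where pq: "\<And>\<omega>. adapted A (p \<omega>)" "\<And>\<omega>. adapted A (q \<omega>)" "\<And>\<omega>. \<omega> = p \<omega> + q \<omega>"
    by metis
  let ?\<Omega> = "p ` Basis \<union> q ` Basis"
  have "b \<in> span ?\<Omega>" if "b \<in> Basis" for b
    using that span_add[of "p b" ?\<Omega> "q b"] pq(3)[of b] by (simp add: span_base)
  then have "span Basis \<subseteq> span ?\<Omega>"
    by (intro span_minimal) auto
  then show ?thesis
    using pq by (intro exI[of _ ?\<Omega>]) auto
qed

section \<open>Tensor products\<close>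

lemma fst_half_measurable [measurable]: "(fst_half :: real ^ ('d::finite + 'd) \<Rightarrow> real ^ 'd) \<in> borel_measurable borel"
  and snd_half_measurable [measurable]: "(snd_half :: real ^ ('d::finite + 'd) \<Rightarrow> real ^ 'd) \<in> borel_measurable borel"
  unfolding fst_half_def snd_half_def
  by (intro borel_measurable_continuous_onI continuous_intros)+

lemma stack_measurable [measurable]:
  "(\<lambda>(x, y). stack x y :: real ^ ('d::finite + 'd)) \<in> borel_measurable (borel \<Otimes>\<^sub>M borel)"
proof -
  have "continuous_on UNIV (\<lambda>p. stack (fst p) (snd p) :: real ^ ('d + 'd))"
    unfolding stack_def
  proof (rule continuous_on_vec_lambda)
    show "continuous_on UNIV (\<lambda>p. case i of Inl k \<Rightarrow> fst p $ k | Inr k \<Rightarrow> snd p $ k)" for i :: "'d + 'd"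
      by (cases i) (auto intro!: continuous_intros)
  qed
  then show ?thesis
    unfolding borel_prod split_beta' by (rule borel_measurable_continuous_onI)
qed

lemma emeasure_lborel_box_cart:
  fixes l u :: "real ^ 'n::finite"
  assumes "\<And>i. l $ i \<le> u $ i"
  shows "emeasure lborel (box l u) = (\<Prod>i\<in>UNIV. u $ i - l $ i)"
proof -
  have "inj (\<lambda>i::'n. axis i (1::real))"
    by (auto simp: inj_on_def axis_eq_axis)
  then have "(\<Prod>b\<in>Basis. (u - l) \<bullet> b) = (\<Prod>i\<in>UNIV. u $ i - l $ i)"
    by (simp add: Basis_vec_def UNION_singleton_eq_range prod.reindex inner_axis)
  moreover have "l \<bullet> b \<le> u \<bullet> b" if "b \<in> Basis" for b
    using that assms by (auto simp: Basis_vec_def inner_axis)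
  ultimately show ?thesis
    by (simp add: emeasure_lborel_box)
qed

text \<open>
  Lebesgue measure is determined by its values on boxes, and a box is the product of its halves.
\<close>

lemma lborel_stack:
  "distr (lborel \<Otimes>\<^sub>M lborel) borel (\<lambda>(x, y). stack x y) = (lborel :: (real ^ ('d::finite + 'd)) measure)"
proof (rule lborel_eqI[symmetric])
  fix l u :: "real ^ ('d + 'd)"
  assume "\<And>b. b \<in> Basis \<Longrightarrow> l \<bullet> b \<le> u \<bullet> b"
  from this[of "axis i 1" for i] have le: "l $ i \<le> u $ i" for i
    by (simp add: inner_axis axis_in_Basis_iff)
  have box: "(\<lambda>(x, y). stack x y) -` box l u = box (fst_half l) (fst_half u) \<times> box (snd_half l) (snd_half u)"
    by (auto simp: mem_box_cart stack_def fst_half_def snd_half_def split: sum.splits)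
  have "emeasure (distr (lborel \<Otimes>\<^sub>M lborel) borel (\<lambda>(x, y). stack x y)) (box l u)
      = emeasure (lborel \<Otimes>\<^sub>M lborel) (box (fst_half l) (fst_half u) \<times> box (snd_half l) (snd_half u))"
    by (subst emeasure_distr) (simp_all add: box space_pair_measure)
  also have "\<dots> = emeasure lborel (box (fst_half l) (fst_half u)) * emeasure lborel (box (snd_half l) (snd_half u))"
    by (rule lborel.emeasure_pair_measure_Times) auto
  also have "\<dots> = ennreal (\<Prod>i\<in>UNIV. u $ Inl i - l $ Inl i) * ennreal (\<Prod>i\<in>UNIV. u $ Inr i - l $ Inr i)"
    using le by (simp add: emeasure_lborel_box_cart fst_half_def snd_half_def)
  also have "\<dots> = ennreal (\<Prod>i\<in>UNIV. u $ i - l $ i)"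
    using le by (simp add: prod_nonneg flip: ennreal_mult)
      (subst UNIV_Plus_UNIV[symmetric], subst prod.Plus, auto simp: comp_def)
  also have "\<dots> = emeasure lborel (box l u)"
    using le by (simp add: emeasure_lborel_box_cart)
  also have "\<dots> = (\<Prod>b\<in>Basis. (u - l) \<bullet> b)"
    using \<open>\<And>b. b \<in> Basis \<Longrightarrow> l \<bullet> b \<le> u \<bullet> b\<close> by (simp add: emeasure_lborel_box)
  finally show "emeasure (distr (lborel \<Otimes>\<^sub>M lborel) borel (\<lambda>(x, y). stack x y)) (box l u) = (\<Prod>b\<in>Basis. (u - l) \<bullet> b)" .
qed simp

lemma tensor_cnj_stack: "tensor_cnj f g (stack x y) = f x * cnj (g y)"
  by (simp add: tensor_cnj_def)

lemma tensor_cnj_bounded_L1: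
  assumes f: "f \<in> bounded_L1" and g: "g \<in> bounded_L1"
  shows "tensor_cnj f g \<in> bounded_L1"
proof -
  note [measurable] = f[THEN bounded_L1_measurable] g[THEN bounded_L1_measurable]
  have [measurable]: "tensor_cnj f g \<in> borel_measurable borel"
    unfolding tensor_cnj_def by measurable
  have int: "integrable lborel f" "integrable lborel g"
    using f g by (simp_all add: bounded_L1_def)
  have "integrable (lborel \<Otimes>\<^sub>M lborel) (\<lambda>(x, y). f x * cnj (g y))"
  proof (rule lborel_pair.Fubini_integrable)
    show "integrable lborel (\<lambda>x. LINT y|lborel. cmod (case (x, y) of (x, y) \<Rightarrow> f x * cnj (g y)))"
      using int by (simp add: norm_mult)
    show "AE x in lborel. integrable lborel (\<lambda>y. case (x, y) of (x, y) \<Rightarrow> f x * cnj (g y))"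
      using int by simp
  qed measurable
  then have "integrable (lborel \<Otimes>\<^sub>M lborel) (\<lambda>p. tensor_cnj f g (case p of (x, y) \<Rightarrow> stack x y))"
    by (simp add: split_beta' tensor_cnj_stack)
  then have "integrable (distr (lborel \<Otimes>\<^sub>M lborel) borel (\<lambda>(x, y). stack x y)) (tensor_cnj f g)"
    by (subst integrable_distr_eq) auto
  moreover obtain C D where "\<And>x. cmod (f x) \<le> C" "\<And>x. cmod (g x) \<le> D"
    using f g by (auto simp: bounded_L1_def bounded_iff)
  then have "cmod (tensor_cnj f g z) \<le> C * D" for z
    unfolding tensor_cnj_def norm_mult complex_mod_cnj
    by (intro mult_mono) (auto intro: order_trans[OF norm_ge_zero])
  then have "bounded (range (tensor_cnj f g))"
    by (auto simp: bounded_iff)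
  ultimately show ?thesis
    by (simp add: bounded_L1_def lborel_stack)
qed

lemma tensor_cnj_ae_zero:
  fixes f g :: "real ^ 'd::finite \<Rightarrow> complex"
  assumes f: "f \<in> borel_measurable borel" and g: "g \<in> borel_measurable borel"
    and zero: "ae_eq f (\<lambda>_. 0) \<or> ae_eq g (\<lambda>_. 0)"
  shows "ae_eq (tensor_cnj f g) (\<lambda>_. 0)"
proof -
  note [measurable] = f g
  have [measurable]: "tensor_cnj f g \<in> borel_measurable borel"
    unfolding tensor_cnj_def by measurable
  have "AE x in lborel. AE y in lborel. f x * cnj (g y) = 0"
    using zero by (auto simp: ae_eq_def elim: eventually_mono)
  then have "AE p in lborel \<Otimes>\<^sub>M lborel. f (fst p) * cnj (g (snd p)) = 0"
  proof (intro lborel_pair.AE_pair_measure)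
    show "{p \<in> space (lborel \<Otimes>\<^sub>M lborel). f (fst p) * cnj (g (snd p)) = 0} \<in> sets (lborel \<Otimes>\<^sub>M lborel)"
      by measurable
  qed simp
  then have "AE p in lborel \<Otimes>\<^sub>M lborel. tensor_cnj f g (case p of (x, y) \<Rightarrow> stack x y) = 0"
    by (simp add: split_beta' tensor_cnj_stack)
  then have "AE z in distr (lborel \<Otimes>\<^sub>M lborel) borel (\<lambda>(x, y). stack x y). tensor_cnj f g z = 0"
    by (subst AE_distr_iff) auto
  then show ?thesis
    unfolding ae_eq_def lborel_stack .
qed

text \<open>
  The phase factors split because the inner product is the sum over the two halves. The sign of the
  frequency changes in the second factor, which enters the tensor product conjugated.
\<close>

lemma tf_shift_tensor_cnj:
  "tf_shift (stack (stack x 0) (stack \<xi> 0)) (tensor_cnj f g) = tensor_cnj (tf_shift (stack x \<xi>) f) g"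
  "tf_shift (stack (stack 0 x) (stack 0 \<xi>)) (tensor_cnj f g) = tensor_cnj f (tf_shift (stack x (- \<xi>)) g)"
proof -
  have "fst_half (t - stack x 0) = fst_half t - x" "snd_half (t - stack x 0) = snd_half t"
    "fst_half (t - stack 0 x) = fst_half t" "snd_half (t - stack 0 x) = snd_half t - x"
    for t :: "real ^ ('a + 'a)" and x
    by (simp_all add: fst_half_def snd_half_def stack_def vec_eq_iff)
  then show "tf_shift (stack (stack x 0) (stack \<xi> 0)) (tensor_cnj f g) = tensor_cnj (tf_shift (stack x \<xi>) f) g"
    "tf_shift (stack (stack 0 x) (stack 0 \<xi>)) (tensor_cnj f g) = tensor_cnj f (tf_shift (stack x (- \<xi>)) g)"
    by (auto simp: fun_eq_iff tf_shift_def tensor_cnj_def Let_def inner_halves exp_cnj)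
qed

lemma fejer_mean_tensor_cnj:
  "fejer_mean (stack (stack x 0) (stack \<xi> 0)) (tensor_cnj f g) = tensor_cnj (fejer_mean (stack x \<xi>) f) g"
  "fejer_mean (stack (stack 0 x) (stack 0 \<xi>)) (tensor_cnj f g) = tensor_cnj f (fejer_mean (stack x (- \<xi>)) g)"
proof -
  have "fejer_mean (stack (stack x 0) (stack \<xi> 0)) (tensor_cnj f g) t = tensor_cnj (fejer_mean (stack x \<xi>) f) g t" for t
    by (simp add: fejer_mean_def scaleR_stack tf_shift_tensor_cnj tensor_cnj_def flip: mult.assoc)
  moreover have "fejer_mean (stack (stack 0 x) (stack 0 \<xi>)) (tensor_cnj f g) t = tensor_cnj f (fejer_mean (stack x (- \<xi>)) g) t" for t
  proof -
    have "tensor_cnj f (fejer_mean (stack x (- \<xi>)) g) t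
        = (CLINT s|lborel. f (fst_half t) * cnj (fejer s * tf_shift (s *\<^sub>R stack x (- \<xi>)) g (snd_half t)))"
      by (simp only: tensor_cnj_def fejer_mean_def Bochner_Integration.integral_cnj[symmetric] integral_mult_right_zero)
    then show ?thesis
      by (simp add: fejer_mean_def scaleR_stack tf_shift_tensor_cnj tensor_cnj_def mult.left_commute)
  qed
  ultimately show
    "fejer_mean (stack (stack x 0) (stack \<xi> 0)) (tensor_cnj f g) = tensor_cnj (fejer_mean (stack x \<xi>) f) g"
    "fejer_mean (stack (stack 0 x) (stack 0 \<xi>)) (tensor_cnj f g) = tensor_cnj f (fejer_mean (stack x (- \<xi>)) g)"
    by auto
qed

lemma exists_nonzero_tensor_cnj:
  "\<exists>f0\<in>bounded_L1. \<exists>g0\<in>bounded_L1.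
    \<not> ae_eq (tensor_cnj f0 g0 :: real ^ ('d::finite + 'd) \<Rightarrow> complex) (\<lambda>_. 0)"
proof -
  let ?f = "\<lambda>x::real ^ 'd. complex_of_real (indicator (ball 0 1) x)"
  have "integrable lborel ?f"
    using emeasure_bounded_finite[OF bounded_ball]
    by (intro integrable_of_real integrable_real_indicator) auto
  moreover have "bounded (range ?f)"
    unfolding bounded_iff by (intro exI[of _ 1]) (auto simp: indicator_def)
  ultimately have f: "?f \<in> bounded_L1"
    by (simp add: bounded_L1_def)
  have "\<not> ae_eq (tensor_cnj ?f ?f) (\<lambda>_. 0)"
  proof
    assume "ae_eq (tensor_cnj ?f ?f) (\<lambda>_. 0)"
    moreover have "tensor_cnj ?f ?f z = 1" if "z \<in> ball 0 1" for z
    proof -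
      have "norm (fst_half z) \<le> norm z" "norm (snd_half z) \<le> norm z"
        by (simp_all add: norm_eq_sqrt_inner inner_halves[of z z])
      then show ?thesis
        using that by (simp add: tensor_cnj_def)
    qed
    ultimately have "AE z in lborel. (z :: real ^ ('d + 'd)) \<notin> ball 0 1"
      unfolding ae_eq_def by (auto elim!: eventually_mono)
    then have "emeasure lborel {z :: real ^ ('d + 'd). norm z < 1} = 0"
      by (subst (asm) AE_iff_measurable[OF _ refl]) auto
    moreover have "{z :: real ^ ('d + 'd). norm z < 1} = ball 0 1"
      by auto
    ultimately have "measure lborel (ball (0 :: real ^ ('d + 'd)) 1) = 0"
      by (simp add: measure_def)
    then show False
      using content_ball_pos[of 1 "0 :: real ^ ('d + 'd)"] by simp
  qed
  with f show ?thesis by blast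
qed

section \<open>Compactness of supports\<close>

lemma ess_support_subset:
  assumes "closed K" "AE x in lborel. x \<notin> K \<longrightarrow> f x = 0"
  shows "ess_support f \<subseteq> K"
proof -
  have "open (- K) \<and> (AE x in lborel. x \<in> - K \<longrightarrow> f x = 0)"
    using assms by (simp add: closed_def)
  then show ?thesis
    unfolding ess_support_def by blast
qed

lemma compact_ess_support:
  assumes "compact K" "AE x in lborel. x \<notin> K \<longrightarrow> f x = 0"
  shows "compact (ess_support f)"
proof -
  have "closed (ess_support f)"
    unfolding ess_support_def by (auto intro: open_Union)
  then have "compact (K \<inter> ess_support f)"
    using assms(1) by (rule compact_Int_closed[rotated])
  moreover have "K \<inter> ess_support f = ess_support f"
    using ess_support_subset[OF compact_imp_closed[OF assms(1)] assms(2)] by blast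
  ultimately show ?thesis by simp
qed

text \<open>
  On the intersection of the slabs every linear functional in the span of \<open>\<Omega>\<close> is bounded, in
  particular every coordinate.
\<close>

lemma compact_slabs:
  fixes \<Omega> :: "'a::euclidean_space set"
  assumes "span \<Omega> = UNIV"
  shows "compact {t. \<forall>\<omega>\<in>\<Omega>. \<bar>\<omega> \<bullet> t\<bar> \<le> c}" (is "compact ?K")
proof -
  have bound: "\<exists>C. \<forall>t\<in>?K. \<bar>v \<bullet> t\<bar> \<le> C" if "v \<in> span \<Omega>" for v
    using that
  proof (induction rule: span_induct_alt)
    case base
    show ?case by (auto intro: exI[of _ 0])
  next
    case (step r \<omega> v)
    then obtain C where C: "\<forall>t\<in>?K. \<bar>v \<bullet> t\<bar> \<le> C" by blast
    have "\<bar>(r *\<^sub>R \<omega> + v) \<bullet> t\<bar> \<le> \<bar>r\<bar> * c + C" if "t \<in> ?K" for t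
    proof -
      have "\<bar>(r *\<^sub>R \<omega> + v) \<bullet> t\<bar> \<le> \<bar>r\<bar> * \<bar>\<omega> \<bullet> t\<bar> + \<bar>v \<bullet> t\<bar>"
        using abs_triangle_ineq[of "r * (\<omega> \<bullet> t)"] by (simp add: inner_add_left abs_mult)
      also have "\<dots> \<le> \<bar>r\<bar> * c + C"
        using that C step.hyps by (intro add_mono mult_left_mono) auto
      finally show ?thesis .
    qed
    then show ?case by blast
  qed
  have "\<forall>b. \<exists>C. \<forall>t\<in>?K. \<bar>b \<bullet> t\<bar> \<le> C"
    using bound assms by simp
  then have "\<exists>C. \<forall>b. \<forall>t\<in>?K. \<bar>b \<bullet> t\<bar> \<le> C b"
    by (rule choice)
  then obtain C where C: "\<And>b t. t \<in> ?K \<Longrightarrow> \<bar>b \<bullet> t\<bar> \<le> C b"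
    by blast
  have "norm t \<le> (\<Sum>b\<in>Basis. C b)" if "t \<in> ?K" for t
  proof -
    have "norm t \<le> (\<Sum>b\<in>Basis. \<bar>t \<bullet> b\<bar>)"
      by (rule norm_le_l1)
    also have "\<dots> \<le> (\<Sum>b\<in>Basis. C b)"
      using C[OF that] by (intro sum_mono) (simp add: inner_commute)
    finally show ?thesis .
  qed
  then have "bounded ?K"
    unfolding bounded_iff by blast
  moreover have "?K = (\<Inter>\<omega>\<in>\<Omega>. {t. \<bar>\<omega> \<bullet> t\<bar> \<le> c})"
    by auto
  then have "closed ?K"
    by (auto intro!: closed_INT closed_Collect_le continuous_intros)
  ultimately show ?thesis
    by (simp add: compact_eq_bounded_closed)
qed

section \<open>Tensor products with compactly supported image\<close>

text \<open>
  Each adapted frequency allows one more averaging step in the tensor factor to which it belongs. The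
  step replaces this factor by its Fejer mean and multiplies the image by one more tent.
\<close>

lemma exists_tensor_with_tent_image:
  assumes T: "metaplectic A T"
    and "finite I" "\<And>i. i \<in> I \<Longrightarrow> adapted A (\<omega> i)"
    and f0: "f0 \<in> bounded_L1" and g0: "g0 \<in> bounded_L1"
  shows "\<exists>f\<in>bounded_L1. \<exists>g\<in>bounded_L1. ae_eq (T (tensor_cnj f g))
    (\<lambda>t. complex_of_real (\<Prod>i\<in>I. tent (2 * pi * (\<omega> i \<bullet> t))) * T (tensor_cnj f0 g0) t)"
  using assms(2,3)
proof (induction I rule: finite_induct)
  case empty
  show ?case
    using f0 g0 by (auto simp: ae_eq_def)
next
  case (insert i I)
  let ?H = "T (tensor_cnj f0 g0)"
  obtain f g where fg: "f \<in> bounded_L1" "g \<in> bounded_L1"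
    and IH: "ae_eq (T (tensor_cnj f g)) (\<lambda>t. complex_of_real (\<Prod>i\<in>I. tent (2 * pi * (\<omega> i \<bullet> t))) * ?H t)"
    using insert by auto
  have step: "ae_eq (T (fejer_mean z (tensor_cnj f g)))
      (\<lambda>t. complex_of_real (\<Prod>i\<in>insert i I. tent (2 * pi * (\<omega> i \<bullet> t))) * ?H t)"
    if "A *v z = stack 0 (\<omega> i)" for z
    using metaplectic_fejer_mean_modulation[OF T that tensor_cnj_bounded_L1[OF fg]] IH
    unfolding ae_eq_def by eventually_elim (simp add: insert.hyps)
  have "adapted A (\<omega> i)"
    using insert.prems by simp
  then consider x \<xi> where "A *v stack (stack x 0) (stack \<xi> 0) = stack 0 (\<omega> i)"
    | x \<xi> where "A *v stack (stack 0 x) (stack 0 \<xi>) = stack 0 (\<omega> i)"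
    unfolding adapted_def by blast
  then show ?case
  proof cases
    case 1
    from step[OF 1] fg show ?thesis
      unfolding fejer_mean_tensor_cnj by (blast intro: fejer_mean_bounded_L1)
  next
    case 2
    from step[OF 2] fg show ?thesis
      unfolding fejer_mean_tensor_cnj by (blast intro: fejer_mean_bounded_L1)
  qed
qed

text \<open>
  With the scaling \<open>r = 1 / (n + 1)\<close> of the spanning adapted frequencies, \<open>w n\<close> is the product of the
  tents. Should \<open>w n \<cdot> T (f0 \<otimes> cnj g0)\<close> vanish almost everywhere for all \<open>n\<close>, then so would \<open>T (f0 \<otimes> cnj g0)\<close>,
  since at each point some \<open>w n\<close> is nonzero.
\<close>

theorem lemma4p2:
  fixes Q L :: "real ^ ('d::finite + 'd) ^ ('d + 'd)"
    and U :: "complex ^ ('d + 'd) ^ ('d + 'd)"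
    and A :: "real ^ (('d + 'd) + ('d + 'd)) ^ (('d + 'd) + ('d + 'd))"
    and T :: "(real ^ ('d + 'd) \<Rightarrow> complex) \<Rightarrow> (real ^ ('d + 'd) \<Rightarrow> complex)"
  assumes "transpose Q = Q"
    and "invertible L"
    and "unitary_matrix U"
    and "A = V_mat Q ** D_mat L ** R_mat U"
    and "metaplectic A T"
    and "block_diagonal (transpose U ** U)"
  shows "\<exists>f\<in>L2. \<exists>g\<in>L2. \<not> ae_eq f (\<lambda>_. 0) \<and> \<not> ae_eq g (\<lambda>_. 0) \<and>
           compact (ess_support (metaplectic_tfr T f g))"
proof -
  obtain \<Omega> where \<Omega>: "finite \<Omega>" "\<And>\<omega>. \<omega> \<in> \<Omega> \<Longrightarrow> adapted A \<omega>" "span \<Omega> = UNIV"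
    using adapted_spanning[OF assms(1,2,3,6,4)] by blast
  obtain f0 g0 :: "real ^ 'd \<Rightarrow> complex" where fg0: "f0 \<in> bounded_L1" "g0 \<in> bounded_L1"
    and nz0: "\<not> ae_eq (tensor_cnj f0 g0) (\<lambda>_. 0)"
    using exists_nonzero_tensor_cnj by blast
  have unitary: "L2_unitary T"
    using assms(5) by (simp add: metaplectic_def)
  have T_zero: "ae_eq (T (tensor_cnj f g)) (\<lambda>_. 0) \<longleftrightarrow> ae_eq (tensor_cnj f g) (\<lambda>_. 0)"
    if "f \<in> bounded_L1" "g \<in> bounded_L1" for f g
    using that by (intro L2_unitary_ae_zero_iff unitary bounded_L1_imp_L2 tensor_cnj_bounded_L1)
  let ?H = "T (tensor_cnj f0 g0)"
  define w where "w n t = (\<Prod>\<omega>\<in>\<Omega>. tent (2 * pi * ((inverse (Suc n) *\<^sub>R \<omega>) \<bullet> t)))" for n t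
  have w_nz: "\<exists>n. w n t \<noteq> 0" for t
  proof -
    \<comment> \<open>As \<open>n\<close> grows, the slabs widen and every tent tends to its peak value \<open>1\<close>.\<close>
    have "(\<lambda>n. w n t) \<longlonglongrightarrow> (\<Prod>\<omega>\<in>\<Omega>. tent (2 * pi * ((0 *\<^sub>R \<omega>) \<bullet> t)))"
      unfolding w_def tent_def by (intro tendsto_intros LIMSEQ_inverse_real_of_nat)
    then have "(\<lambda>n. w n t) \<longlonglongrightarrow> 1"
      by (simp add: tent_def)
    then have "eventually (\<lambda>n. w n t \<noteq> 0) sequentially"
      by (rule tendsto_imp_eventually_ne) simp
    then show ?thesis
      by (auto simp: eventually_sequentially)
  qed
  have "ae_eq ?H (\<lambda>_. 0)" if "\<And>n. ae_eq (\<lambda>t. complex_of_real (w n t) * ?H t) (\<lambda>_. 0)"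
  proof -
    have "AE t in lborel. \<forall>n. complex_of_real (w n t) * ?H t = 0"
      using that unfolding ae_eq_def by (intro AE_all_countable[THEN iffD2] allI)
    then show ?thesis
      unfolding ae_eq_def
    proof eventually_elim
      case (elim t)
      with w_nz[of t] show ?case by auto
    qed
  qed
  then obtain n where n: "\<not> ae_eq (\<lambda>t. complex_of_real (w n t) * ?H t) (\<lambda>_. 0)"
    using nz0 T_zero[OF fg0] by blast
  define r where "r = inverse (real (Suc n))"
  have "r > 0"
    by (simp add: r_def)
  obtain f g where fg: "f \<in> bounded_L1" "g \<in> bounded_L1"
    and Tfg: "ae_eq (T (tensor_cnj f g)) (\<lambda>t. complex_of_real (w n t) * ?H t)"
    using exists_tensor_with_tent_image[OF assms(5) \<Omega>(1), of "\<lambda>\<omega>. r *\<^sub>R \<omega>", OF adapted_scaleR[OF \<Omega>(2)] fg0]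
    unfolding w_def r_def by blast
  let ?K = "{t. \<forall>\<omega>\<in>\<Omega>. \<bar>\<omega> \<bullet> t\<bar> \<le> 1 / (2 * pi * r)}"
  have w_zero: "w n t = 0" if "t \<notin> ?K" for t
  proof -
    obtain \<omega> where \<omega>: "\<omega> \<in> \<Omega>" "\<bar>\<omega> \<bullet> t\<bar> > 1 / (2 * pi * r)"
      using \<open>t \<notin> ?K\<close> by (auto simp: not_le)
    then have "\<bar>2 * pi * (r * (\<omega> \<bullet> t))\<bar> > 1"
      using \<open>r > 0\<close> by (simp add: abs_mult field_simps)
    then have "tent (2 * pi * ((inverse (Suc n) *\<^sub>R \<omega>) \<bullet> t)) = 0"
      by (simp add: tent_def r_def)
    then show ?thesis
      unfolding w_def using \<Omega>(1) \<omega>(1) by (intro prod_zero) auto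
  qed
  have "AE t in lborel. t \<notin> ?K \<longrightarrow> T (tensor_cnj f g) t = 0"
    using Tfg unfolding ae_eq_def
  proof eventually_elim
    case (elim t)
    show ?case
      using w_zero[of t] elim by (intro impI) simp
  qed
  then have "compact (ess_support (metaplectic_tfr T f g))"
    unfolding metaplectic_tfr_def by (intro compact_ess_support[OF compact_slabs[OF \<Omega>(3)]])
  moreover have "\<not> ae_eq (tensor_cnj f g) (\<lambda>_. 0)"
  proof
    assume "ae_eq (tensor_cnj f g) (\<lambda>_. 0)"
    then have "ae_eq (T (tensor_cnj f g)) (\<lambda>_. 0)"
      using T_zero[OF fg] by simp
    with Tfg have "ae_eq (\<lambda>t. complex_of_real (w n t) * ?H t) (\<lambda>_. 0)"
      unfolding ae_eq_def by eventually_elim simp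
    with n show False ..
  qed
  then have "\<not> ae_eq f (\<lambda>_. 0)" "\<not> ae_eq g (\<lambda>_. 0)"
    using tensor_cnj_ae_zero[OF fg[THEN bounded_L1_measurable]] by blast+
  ultimately show ?thesis
    using fg[THEN bounded_L1_imp_L2] by blast
qed
end
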